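(* Let $d\geq 1$ and $n\geq d+1$ be integers, let $S=K[x_1,\ldots,x_n]$ be a polynomial ring over a field $K$, let $G$ be the $d$-path on the vertex set $\{1,\ldots,n\}$, and let $I(\bar G)\subset S$ be the edge ideal of its complementary graph $\bar G$ (an anti-$d$-path). For all integers $k\geq 1$, the ideal $I(\bar G)^k$ has linear quotients with respect to the decreasing lexicographical order of its minimal monomial generators.
   Context: A $d$-path is the graph on $\{1,\ldots,n\}$ which is the union of the complete graphs on the vertex sets $\{1,\ldots,d+1\},\{2,\ldots,d+2\},\ldots,\{n-d,\ldots,n\}$. Its complementary graph $\bar G$ is called an anti-$d$-path, and its edge ideal is $I(\bar G)=(x_ix_j : 1\leq i,j\leq n,\ i+d<j)$. The lexicographic order is taken with $x_1>_{lex}\cdots>_{lex}x_n$. A monomial ideal $J$ has linear quotients with respect to an ordering $u_1,\ldots,u_s$ of its minimal monomial generators if for all $2\leq i\leq s$ the colon ideal $(u_1,\ldots,u_{i-1}):u_i$ is generated by variables. *)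

theory Defs
  imports "HOL-Algebra.Ideal_Product" "HOL-Library.Poly_Mapping"
begin

section \<open>Graphs\<close>

text \<open>A simple graph is given by its set of edges, each edge being a two-element set of vertices.\<close>

definition complete_edges :: "nat set \<Rightarrow> nat set set" where
  "complete_edges V = {e. e \<subseteq> V \<and> card e = 2}"

definition d_path :: "nat \<Rightarrow> nat \<Rightarrow> nat set set" where
  "d_path d n = (\<Union>i\<in>{1..n - d}. complete_edges {i..i + d})"

definition complement_edges :: "nat \<Rightarrow> nat set set \<Rightarrow> nat set set" where
  "complement_edges n E = complete_edges {1..n} - E"


section \<open>The polynomial ring in the variables indexed by \<open>{1..n}\<close>\<close>

text \<open>Monomials are identified with their exponent vectors.  The library's linear order on
  \<^typ>\<open>nat \<Rightarrow>\<^sub>0 nat\<close> compares exponents at the first index where they differ, so it is the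
  lexicographic order in which variables with smaller index are larger; see \<open>lex_less_iff\<close> and
  \<open>lex_less_var\<close> below.\<close>

type_synonym mon = "nat \<Rightarrow>\<^sub>0 nat"
type_synonym 'k mpoly = "mon \<Rightarrow>\<^sub>0 'k"

definition monoms :: "nat \<Rightarrow> mon set" where
  "monoms n = {m. Poly_Mapping.keys m \<subseteq> {1..n}}"

definition poly_ring :: "nat \<Rightarrow> ('k::field) mpoly ring" where
  "poly_ring n = \<lparr> carrier = {p. Poly_Mapping.keys p \<subseteq> monoms n}, mult = (*), one = 1, zero = 0, add = (+) \<rparr>"

definition monom :: "mon \<Rightarrow> ('k::field) mpoly" where
  "monom m = Poly_Mapping.single m 1"

definition var :: "nat \<Rightarrow> ('k::field) mpoly" where
  "var i = monom (Poly_Mapping.single i 1)"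

definition edge_ideal :: "nat \<Rightarrow> nat set set \<Rightarrow> ('k::field) mpoly set" where
  "edge_ideal n E = Idl\<^bsub>poly_ring n\<^esub> {var i \<otimes>\<^bsub>poly_ring n\<^esub> var j | i j. {i, j} \<in> E}"


section \<open>Linear quotients\<close>

definition colon :: "('a, 'b) ring_scheme \<Rightarrow> 'a set \<Rightarrow> 'a \<Rightarrow> 'a set" where
  "colon R I u = {f \<in> carrier R. f \<otimes>\<^bsub>R\<^esub> u \<in> I}"

text \<open>A monomial ideal has exactly one minimal set of monomial generators.\<close>

definition minimal_monomial_generators :: "nat \<Rightarrow> ('k::field) mpoly set \<Rightarrow> mon set \<Rightarrow> bool" where
  "minimal_monomial_generators n J B \<longleftrightarrow>
     B \<subseteq> monoms n \<and> Idl\<^bsub>poly_ring n\<^esub> (monom ` B) = J \<and>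
     (\<forall>C. C \<subset> B \<longrightarrow> Idl\<^bsub>poly_ring n\<^esub> (monom ` C) \<noteq> J)"

text \<open>Lists are indexed from 0: the generators preceding \<open>us ! i\<close> are \<open>take i us\<close>.\<close>

definition linear_quotients :: "nat \<Rightarrow> ('k::field) mpoly set \<Rightarrow> mon list \<Rightarrow> bool" where
  "linear_quotients n (J :: 'k mpoly set) us \<longleftrightarrow>
     distinct us \<and> minimal_monomial_generators n J (set us) \<and>
     (\<forall>i. 1 \<le> i \<and> i < length us \<longrightarrow>
        (\<exists>V \<subseteq> {1..n}.
           colon (poly_ring n :: 'k mpoly ring) (Idl\<^bsub>poly_ring n\<^esub> (monom ` set (take i us))) (monom (us ! i))
           = Idl\<^bsub>poly_ring n\<^esub> (var ` V)))"

definition decreasing_lex_generators :: "nat \<Rightarrow> ('k::field) mpoly set \<Rightarrow> mon list \<Rightarrow> bool" where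
  "decreasing_lex_generators n J us \<longleftrightarrow>
     minimal_monomial_generators n J (set us) \<and> sorted_wrt (>) us"


section \<open>Basic facts\<close>

lemma lex_less_iff:
  fixes u v :: mon
  shows "u < v \<longleftrightarrow> (\<exists>i. Poly_Mapping.lookup u i < Poly_Mapping.lookup v i \<and> (\<forall>j<i. Poly_Mapping.lookup u j = Poly_Mapping.lookup v j))"
  by (simp add: less_poly_mapping.rep_eq less_fun_def)

lemma lex_less_var:
  "Poly_Mapping.single j (1::nat) < Poly_Mapping.single i 1 \<longleftrightarrow> i < (j::nat)"
  unfolding less_poly_mapping.rep_eq less_fun_def
  by (auto simp: lookup_single when_def split: if_splits)

lemma monoms_zero: "0 \<in> monoms n"
  by (simp add: monoms_def)

lemma monoms_add: "a \<in> monoms n \<Longrightarrow> b \<in> monoms n \<Longrightarrow> a + b \<in> monoms n"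
  using Poly_Mapping.keys_add[of a b] by (auto simp: monoms_def)

lemma cring_poly_ring: "cring (poly_ring n :: ('k::field) mpoly ring)"
proof (rule cringI)
  let ?R = "poly_ring n :: 'k mpoly ring"
  show "abelian_group ?R"
  proof (rule abelian_groupI)
    fix x y assume "x \<in> carrier ?R" "y \<in> carrier ?R"
    then show "x \<oplus>\<^bsub>?R\<^esub> y \<in> carrier ?R"
      using Poly_Mapping.keys_add[of x y] by (auto simp: poly_ring_def)
  next
    fix x assume "x \<in> carrier ?R"
    then show "\<exists>y\<in>carrier ?R. y \<oplus>\<^bsub>?R\<^esub> x = \<zero>\<^bsub>?R\<^esub>"
      by (intro bexI[of _ "- x"]) (auto simp: poly_ring_def)
  qed (auto simp: poly_ring_def algebra_simps)
  show "comm_monoid ?R"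
  proof (rule comm_monoidI)
    fix x y assume "x \<in> carrier ?R" "y \<in> carrier ?R"
    then show "x \<otimes>\<^bsub>?R\<^esub> y \<in> carrier ?R"
      using keys_mult[of x y] monoms_add by (fastforce simp: poly_ring_def)
  qed (auto simp: poly_ring_def algebra_simps monoms_zero)
qed (auto simp: poly_ring_def algebra_simps)

lemma complement_d_path:
  assumes "n \<ge> d + 1"
  shows "complement_edges n (d_path d n) = {{i, j} | i j. 1 \<le> i \<and> i + d < j \<and> j \<le> n}"
proof (intro Set.set_eqI iffI)
  fix e assume e: "e \<in> complement_edges n (d_path d n)"
  then have "card e = 2" and sub: "e \<subseteq> {1..n}"
    by (auto simp: complement_edges_def complete_edges_def)
  then obtain a b where ab: "e = {a, b}" "a \<noteq> b" by (meson card_2_iff)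
  define i j where "i = min a b" and "j = max a b"
  have ij: "e = {i, j}" "i < j" "1 \<le> i" "j \<le> n"
    using ab sub by (auto simp: i_def j_def min_def max_def)
  have "i + d < j"
  proof (rule ccontr)
    assume "\<not> i + d < j"
    define l where "l = min i (n - d)"
    have "l \<in> {1..n - d}" using assms ij by (auto simp: l_def)
    moreover have "e \<subseteq> {l..l + d}"
      using assms ij \<open>\<not> i + d < j\<close> by (auto simp: l_def min_def)
    ultimately have "e \<in> d_path d n"
      using \<open>card e = 2\<close> by (auto simp: d_path_def complete_edges_def)
    with e show False by (simp add: complement_edges_def)
  qed
  with ij show "e \<in> {{i, j} | i j. 1 \<le> i \<and> i + d < j \<and> j \<le> n}" by auto
next
  fix e assume "e \<in> {{i, j} | i j. 1 \<le> i \<and> i + d < j \<and> j \<le> n}"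
  then obtain i j where ij: "e = {i, j}" "1 \<le> i" "i + d < j" "j \<le> n" by auto
  then show "e \<in> complement_edges n (d_path d n)"
    by (auto simp: complement_edges_def complete_edges_def d_path_def card_2_iff)
qed

lemma edge_ideal_complement_d_path:
  assumes "n \<ge> d + 1"
  shows "(edge_ideal n (complement_edges n (d_path d n)) :: ('k::field) mpoly set) =
    Idl\<^bsub>poly_ring n\<^esub> {var i \<otimes>\<^bsub>poly_ring n\<^esub> var j | i j. 1 \<le> i \<and> i + d < j \<and> j \<le> n}"
proof -
  have "{var i \<otimes>\<^bsub>poly_ring n\<^esub> var j :: 'k mpoly | i j. {i, j} \<in> complement_edges n (d_path d n)} =
    {var i \<otimes>\<^bsub>poly_ring n\<^esub> var j | i j. 1 \<le> i \<and> i + d < j \<and> j \<le> n}"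
    unfolding complement_d_path[OF assms]
    by (auto simp: doubleton_eq_iff poly_ring_def) (metis mult.commute)+
  then show ?thesis by (simp add: edge_ideal_def)
qed

end

theory Submission
  imports Defs
begin

text \<open>A monomial of degree \<open>2 * k\<close> is a product of \<open>k\<close> edges of the anti-\<open>d\<close>-path iff its exponents
  over every window \<open>{s..s + d}\<close> sum to at most \<open>k\<close>: an edge meets each window at most once, and
  conversely one can always split off an edge that meets every full window.
  Now let \<open>u < v\<close> be two such monomials and let \<open>i\<close> be the first index where their exponents differ.
  In every full window of \<open>u\<close> containing \<open>i\<close>, the exponent of \<open>u\<close> exceeds that of \<open>v\<close> at some index
  \<open>q > i\<close>, and the \<open>q\<close> found in the leftmost such window lies in all of them. Hence \<open>x\<^sub>i u / x\<^sub>q\<close> is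
  again a generator; it is larger than \<open>u\<close>, and \<open>x\<^sub>i\<close> divides \<open>v / gcd(u, v)\<close>.\<close>

section \<open>Monomial ideals\<close>

definition mon_dvd :: "mon \<Rightarrow> mon \<Rightarrow> bool" where
  "mon_dvd a b \<longleftrightarrow> (\<forall>i. Poly_Mapping.lookup a i \<le> Poly_Mapping.lookup b i)"

text \<open>The ideal generated by the monomials of \<open>B\<close>, described through supports:
  membership, products and colons become questions about divisibility of exponent vectors.
  \<open>genideal_monom\<close> identifies it with the generated ideal.\<close>

definition monomial_ideal :: "nat \<Rightarrow> mon set \<Rightarrow> ('k::field) mpoly set" where
  "monomial_ideal n B =
     {p \<in> carrier (poly_ring n). \<forall>m\<in>Poly_Mapping.keys p. \<exists>b\<in>B. mon_dvd b m}"

lemma mon_dvd_refl [simp]: "mon_dvd a a"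
  by (simp add: mon_dvd_def)

lemma mon_dvd_trans [trans]: "mon_dvd a b \<Longrightarrow> mon_dvd b c \<Longrightarrow> mon_dvd a c"
  unfolding mon_dvd_def using le_trans by blast

lemma mon_dvd_antisym: "mon_dvd a b \<Longrightarrow> mon_dvd b a \<Longrightarrow> a = b"
  by (intro poly_mapping_eqI) (auto simp: mon_dvd_def intro: le_antisym)

lemma mon_dvd_iff: "mon_dvd a b \<longleftrightarrow> (\<exists>c. b = a + c)"
proof
  assume "mon_dvd a b"
  then have "b = a + (b - a)"
    by (intro poly_mapping_eqI) (simp add: mon_dvd_def lookup_add lookup_minus)
  then show "\<exists>c. b = a + c" ..
qed (auto simp: mon_dvd_def lookup_add)

lemma mon_dvd_add_mono: "mon_dvd a b \<Longrightarrow> mon_dvd c d \<Longrightarrow> mon_dvd (a + c) (b + d)"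
  by (simp add: mon_dvd_def lookup_add add_mono)

lemma mon_dvd_single: "mon_dvd (Poly_Mapping.single i 1) m \<longleftrightarrow> 1 \<le> Poly_Mapping.lookup m i"
  by (auto simp: mon_dvd_def lookup_single when_def)

lemma monoms_dvd: "mon_dvd a b \<Longrightarrow> b \<in> monoms n \<Longrightarrow> a \<in> monoms n"
  unfolding mon_dvd_def monoms_def by (metis (mono_tags, lifting) in_keys_iff le_zero_eq mem_Collect_eq subset_eq)

lemma monoms_single: "i \<in> {1..n} \<Longrightarrow> Poly_Mapping.single i 1 \<in> monoms n"
  by (auto simp: monoms_def)

lemma monom_carrier: "m \<in> monoms n \<Longrightarrow> monom m \<in> carrier (poly_ring n)"
  by (simp add: monom_def poly_ring_def)

lemma keys_monom [simp]: "Poly_Mapping.keys (monom m :: ('k::field) mpoly) = {m}"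
  by (simp add: monom_def)

lemma monom_add: "monom (a + b) = monom a * monom b"
  by (simp add: monom_def mult_single)

text \<open>Multiplying by a monomial shifts exponents injectively, so no terms cancel. This gives
  the lower bound on the support of \<open>f * monom u\<close> that complements the upper bound
  \<open>keys_mult\<close>.\<close>

lemma lookup_mult_monom:
  fixes f :: "('k::field) mpoly"
  shows "Poly_Mapping.lookup (f * monom u) (m + u) = Poly_Mapping.lookup f m"
proof -
  have "(\<Sum>q. Poly_Mapping.lookup (monom u :: 'k mpoly) q when m + u = k + q) =
      (1 when k = m)" for k
  proof -
    have "(\<Sum>q. Poly_Mapping.lookup (monom u :: 'k mpoly) q when m + u = k + q) =
      (\<Sum>q. (1 when m = k) when q = u)"
      by (rule Sum_any.cong) (auto simp: monom_def lookup_single when_def)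
    then show ?thesis by (cases "m = k") simp_all
  qed
  then show ?thesis
    by (simp add: lookup_mult mult_when)
qed

lemma poly_mapping_eq_sum_single:
  fixes p :: "'a \<Rightarrow>\<^sub>0 'b::comm_monoid_add"
  shows "p = (\<Sum>m\<in>Poly_Mapping.keys p. Poly_Mapping.single m (Poly_Mapping.lookup p m))"
proof (rule poly_mapping_eqI)
  fix k
  have "(\<Sum>m\<in>Poly_Mapping.keys p. Poly_Mapping.lookup p m when m = k) =
      Poly_Mapping.lookup p k"
    by (auto simp: when_def in_keys_iff sum.delta)
  then show "Poly_Mapping.lookup p k =
    Poly_Mapping.lookup (\<Sum>m\<in>Poly_Mapping.keys p. Poly_Mapping.single m (Poly_Mapping.lookup p m)) k"
    by (simp add: lookup_sum lookup_single)
qed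

lemma ideal_monomial_ideal: "ideal (monomial_ideal n B :: ('k::field) mpoly set) (poly_ring n)"
proof -
  let ?R = "poly_ring n :: 'k mpoly ring" and ?M = "monomial_ideal n B :: 'k mpoly set"
  interpret cring ?R by (rule cring_poly_ring)
  \<comment> \<open>Negation is not a field of the record \<open>poly_ring\<close>; it is determined
    by uniqueness of additive inverses.\<close>
  have uminus: "\<ominus>\<^bsub>?R\<^esub> x = - x" if "x \<in> carrier ?R" for x
  proof (rule minus_equality)
    show "- x \<oplus>\<^bsub>?R\<^esub> x = \<zero>\<^bsub>?R\<^esub>" "- x \<in> carrier ?R"
      using that by (simp_all add: poly_ring_def)
  qed (fact that)
  have mult: "x \<otimes>\<^bsub>?R\<^esub> p \<in> ?M" if p: "p \<in> ?M" and x: "x \<in> carrier ?R" for x p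
  proof -
    have "\<exists>b\<in>B. mon_dvd b m" if m: "m \<in> Poly_Mapping.keys (x * p)" for m
    proof -
      obtain a c where "m = a + c" "c \<in> Poly_Mapping.keys p"
        using m keys_mult[of x p] by blast
      moreover from this p obtain b where "b \<in> B" "mon_dvd b c"
        by (auto simp: monomial_ideal_def)
      ultimately show ?thesis by (auto simp: mon_dvd_def lookup_add intro: trans_le_add2)
    qed
    then show ?thesis using p x m_closed[of x p] by (auto simp: monomial_ideal_def poly_ring_def)
  qed
  show ?thesis
  proof (rule idealI)
    show "ring ?R" by (rule ring_axioms)
    show "subgroup ?M (add_monoid ?R)"
    proof (rule add.subgroupI)
      show "?M \<subseteq> carrier ?R" by (auto simp: monomial_ideal_def)
      have "0 \<in> ?M" by (simp add: monomial_ideal_def poly_ring_def)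
      then show "?M \<noteq> {}" by blast
    next
      fix p assume "p \<in> ?M"
      then show "\<ominus>\<^bsub>?R\<^esub> p \<in> ?M"
        using uminus[of p] by (simp add: monomial_ideal_def) (simp add: poly_ring_def)
    next
      fix p q assume *: "p \<in> ?M" "q \<in> ?M"
      then have "p \<oplus>\<^bsub>?R\<^esub> q \<in> carrier ?R" by (auto simp: monomial_ideal_def)
      with * show "p \<oplus>\<^bsub>?R\<^esub> q \<in> ?M"
        using Poly_Mapping.keys_add[of p q] by (auto simp: monomial_ideal_def poly_ring_def)
    qed
    fix p x assume *: "p \<in> ?M" "x \<in> carrier ?R"
    then show "x \<otimes>\<^bsub>?R\<^esub> p \<in> ?M" by (rule mult)
    moreover have "p \<in> carrier ?R" using *(1) by (simp add: monomial_ideal_def)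
    ultimately show "p \<otimes>\<^bsub>?R\<^esub> x \<in> ?M" using m_comm *(2) by metis
  qed
qed

lemma monom_in_monomial_ideal:
  assumes "m \<in> monoms n"
  shows "(monom m :: ('k::field) mpoly) \<in> monomial_ideal n B \<longleftrightarrow> (\<exists>b\<in>B. mon_dvd b m)"
  using assms by (simp add: monomial_ideal_def monom_carrier)

text \<open>A polynomial is the finite sum of its terms, and a term whose exponent is divisible by
  some \<open>b\<close> in \<open>B\<close> is a ring multiple of \<open>monom b\<close>. Conversely
  the right-hand side is an ideal containing the generators.\<close>

lemma genideal_monom:
  assumes "B \<subseteq> monoms n"
  shows "Idl\<^bsub>poly_ring n\<^esub> (monom ` B) = (monomial_ideal n B :: ('k::field) mpoly set)"
proof
  let ?R = "poly_ring n :: 'k mpoly ring" and ?M = "monomial_ideal n B :: 'k mpoly set"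
  interpret cring ?R by (rule cring_poly_ring)
  have carr: "monom ` B \<subseteq> carrier ?R"
    using assms monom_carrier by blast
  show "Idl\<^bsub>?R\<^esub> (monom ` B) \<subseteq> ?M"
  proof (rule genideal_minimal)
    show "monom ` B \<subseteq> ?M"
      using assms monom_in_monomial_ideal mon_dvd_refl by blast
  qed (rule ideal_monomial_ideal)
  show "?M \<subseteq> Idl\<^bsub>?R\<^esub> (monom ` B)"
  proof
    fix p assume p: "p \<in> ?M"
    interpret I: ideal "Idl\<^bsub>?R\<^esub> (monom ` B)" ?R by (rule genideal_ideal[OF carr])
    have term_in: "Poly_Mapping.single m (Poly_Mapping.lookup p m) \<in> Idl\<^bsub>?R\<^esub> (monom ` B)"
      if m: "m \<in> Poly_Mapping.keys p" for m
    proof -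
      obtain b c where b: "b \<in> B" "m = b + c"
        using p m by (auto simp: monomial_ideal_def mon_dvd_iff)
      have "m \<in> monoms n" using p m by (auto simp: monomial_ideal_def poly_ring_def)
      then have "c \<in> monoms n"
        by (rule monoms_dvd[rotated]) (auto simp: b mon_dvd_def lookup_add)
      then have "Poly_Mapping.single c (Poly_Mapping.lookup p m) \<in> carrier ?R"
        by (auto simp: poly_ring_def)
      moreover have "monom b \<in> Idl\<^bsub>?R\<^esub> (monom ` B)"
        using genideal_self[OF carr] b by blast
      ultimately have "Poly_Mapping.single c (Poly_Mapping.lookup p m) \<otimes>\<^bsub>?R\<^esub> monom b \<in> Idl\<^bsub>?R\<^esub> (monom ` B)"
        by (simp add: I.I_l_closed)
      then show ?thesis by (simp add: poly_ring_def monom_def mult_single b add.commute)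
    qed
    \<comment> \<open>Induction over subsets of the support, with the type-level sum built up by the
      ideal's closure under addition.\<close>
    have "(\<Sum>m\<in>A. Poly_Mapping.single m (Poly_Mapping.lookup p m)) \<in> Idl\<^bsub>?R\<^esub> (monom ` B)"
      if "A \<subseteq> Poly_Mapping.keys p" "finite A" for A
      using that(2,1)
    proof (induction A rule: finite_induct)
      case empty
      then show ?case using I.zero_closed by (simp add: poly_ring_def)
    next
      case (insert m A)
      then show ?case using I.a_closed term_in by (auto simp: poly_ring_def)
    qed
    then show "p \<in> Idl\<^bsub>?R\<^esub> (monom ` B)"
      using poly_mapping_eq_sum_single[of p] by (metis finite_keys order_refl)
  qed
qed

lemma genideal_var:
  assumes "V \<subseteq> {1..n}"
  shows "Idl\<^bsub>poly_ring n\<^esub> (var ` V) =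
    (monomial_ideal n ((\<lambda>i. Poly_Mapping.single i 1) ` V) :: ('k::field) mpoly set)"
proof -
  have "(\<lambda>i. Poly_Mapping.single i 1) ` V \<subseteq> monoms n"
    using assms monoms_single by blast
  from genideal_monom[OF this] show ?thesis by (simp add: image_image var_def)
qed

text \<open>One inclusion compares supports: every exponent of \<open>p * q\<close> is a sum of an
  exponent of \<open>p\<close> and one of \<open>q\<close>. The other needs only that the product
  ideal contains each \<open>monom (b + c)\<close>.\<close>

lemma monomial_ideal_prod:
  assumes "B \<subseteq> monoms n" "C \<subseteq> monoms n"
  shows "ideal_prod (poly_ring n) (monomial_ideal n B) (monomial_ideal n C) =
    (monomial_ideal n {b + c | b c. b \<in> B \<and> c \<in> C} :: ('k::field) mpoly set)"
    (is "?P = monomial_ideal n ?D")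
proof
  let ?R = "poly_ring n :: 'k mpoly ring"
  interpret cring ?R by (rule cring_poly_ring)
  have D: "?D \<subseteq> monoms n" using assms monoms_add by blast
  show "?P \<subseteq> monomial_ideal n ?D"
  proof
    fix p assume "p \<in> ?P"
    then show "p \<in> monomial_ideal n ?D"
    proof induction
      case (prod p q)
      then have carr: "p \<otimes>\<^bsub>?R\<^esub> q \<in> carrier ?R" by (simp add: monomial_ideal_def)
      have "\<exists>b\<in>?D. mon_dvd b m" if m: "m \<in> Poly_Mapping.keys (p * q)" for m
      proof -
        obtain x y where "m = x + y" "x \<in> Poly_Mapping.keys p" "y \<in> Poly_Mapping.keys q"
          using m keys_mult[of p q] by blast
        moreover from this prod obtain b c where
          "b \<in> B" "mon_dvd b x" "c \<in> C" "mon_dvd c y"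
          by (fastforce simp: monomial_ideal_def)
        ultimately show ?thesis using mon_dvd_add_mono by blast
      qed
      with carr show ?case by (simp add: monomial_ideal_def) (simp add: poly_ring_def)
    next
      case (sum p q)
      then show ?case
        using additive_subgroup.a_closed[OF ideal.axioms(1)[OF ideal_monomial_ideal]] by blast
    qed
  qed
  have "Idl\<^bsub>?R\<^esub> (monom ` ?D) \<subseteq> ?P"
  proof (rule genideal_minimal)
    show "ideal ?P ?R" by (intro ideal_prod_is_ideal ideal_monomial_ideal)
    show "monom ` ?D \<subseteq> ?P"
    proof
      fix p :: "'k mpoly" assume "p \<in> monom ` ?D"
      then obtain b c where bc: "p = monom (b + c)" "b \<in> B" "c \<in> C" by blast
      then have "monom b \<in> monomial_ideal n B" "monom c \<in> monomial_ideal n C"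
        using assms monom_in_monomial_ideal mon_dvd_refl by blast+
      then have "monom b \<otimes>\<^bsub>?R\<^esub> monom c \<in> ?P" by (rule ideal_prod.prod)
      then show "p \<in> ?P" by (simp add: bc monom_add poly_ring_def)
    qed
  qed
  then show "monomial_ideal n ?D \<subseteq> ?P" by (simp add: genideal_monom[OF D])
qed

lemma monomial_ideal_zero: "monomial_ideal n {0} = carrier (poly_ring n)"
  by (auto simp: monomial_ideal_def mon_dvd_def)

text \<open>If \<open>C\<close> generates the same ideal as the antichain \<open>B\<close>, every
  element of either set is divisible by one of the other. A chain \<open>c'\<close> divides
  \<open>b\<close> divides \<open>c\<close> collapses by minimality of \<open>C\<close>, which gives
  \<open>C \<subseteq> B\<close>; the antichain property gives the converse.\<close>

lemma minimal_monomial_generators_unique: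
  assumes anti: "\<And>b c. b \<in> B \<Longrightarrow> c \<in> B \<Longrightarrow> mon_dvd b c \<Longrightarrow> b = c"
    and B: "B \<subseteq> monoms n"
  shows "minimal_monomial_generators n (monomial_ideal n B :: ('k::field) mpoly set) C \<longleftrightarrow> C = B"
proof
  let ?M = "\<lambda>B. monomial_ideal n B :: 'k mpoly set"
  assume C: "minimal_monomial_generators n (?M B) C"
  then have Cm: "C \<subseteq> monoms n" by (simp add: minimal_monomial_generators_def)
  have CB: "?M C = ?M B"
    using C genideal_monom[OF Cm, where 'k = 'k] by (simp add: minimal_monomial_generators_def)
  have Cmin: "?M D \<noteq> ?M B" if "D \<subset> C" for D
  proof -
    have "D \<subseteq> monoms n" using that Cm by blast
    moreover have "Idl\<^bsub>poly_ring n\<^esub> (monom ` D) \<noteq> ?M B"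
      using C that by (simp add: minimal_monomial_generators_def)
    ultimately show ?thesis by (simp add: genideal_monom)
  qed
  have BdC: "\<exists>c\<in>C. mon_dvd c b" if "b \<in> B" for b
  proof -
    have "(monom b :: 'k mpoly) \<in> ?M B" using that B monom_in_monomial_ideal mon_dvd_refl by blast
    then show ?thesis using CB that B monom_in_monomial_ideal by blast
  qed
  have CdB: "\<exists>b\<in>B. mon_dvd b c" if "c \<in> C" for c
  proof -
    have "(monom c :: 'k mpoly) \<in> ?M C" using that Cm monom_in_monomial_ideal mon_dvd_refl by blast
    then show ?thesis using CB that Cm monom_in_monomial_ideal by blast
  qed
  have "C \<subseteq> B"
  proof
    fix c assume c: "c \<in> C"
    obtain b where b: "b \<in> B" "mon_dvd b c" using CdB c by blast
    obtain c' where c': "c' \<in> C" "mon_dvd c' b" using BdC b by blast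
    have "c' = c"
    proof (rule ccontr)
      \<comment> \<open>Then \<open>c\<close> is redundant in \<open>C\<close>: everything it
        divides is already divisible by \<open>c'\<close>.\<close>
      assume "c' \<noteq> c"
      then have "\<exists>x\<in>C - {c}. mon_dvd x m" if "\<exists>x\<in>C. mon_dvd x m" for m
        using that c' b(2) mon_dvd_trans by blast
      then have "?M (C - {c}) = ?M C" unfolding monomial_ideal_def by blast
      then show False using Cmin[of "C - {c}"] CB c by blast
    qed
    then show "c \<in> B" using b c' mon_dvd_antisym by blast
  qed
  moreover have "B \<subseteq> C" using BdC anti calculation by blast
  ultimately show "C = B" by blast
next
  let ?M = "\<lambda>B. monomial_ideal n B :: 'k mpoly set"
  assume [simp]: "C = B"
  have "?M D \<noteq> ?M B" if D: "D \<subset> B" for D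
  proof
    assume eq: "?M D = ?M B"
    obtain b where b: "b \<in> B" "b \<notin> D" using D by blast
    then have "(monom b :: 'k mpoly) \<in> ?M B" using B monom_in_monomial_ideal mon_dvd_refl by blast
    then obtain c where "c \<in> D" "mon_dvd c b" using eq b B monom_in_monomial_ideal by blast
    then show False using anti b D by blast
  qed
  moreover have "Idl\<^bsub>poly_ring n\<^esub> (monom ` D) = ?M D" if "D \<subset> B" for D
    using that B by (intro genideal_monom) blast
  ultimately show "minimal_monomial_generators n (?M B) C"
    using B by (simp add: minimal_monomial_generators_def genideal_monom)
qed

section \<open>Colon ideals by a monomial, and lexicographic initial segments\<close>

lemma colon_monomial_ideal:
  assumes u: "u \<in> monoms n"
  shows "colon (poly_ring n) (monomial_ideal n P) (monom u) =
    {f \<in> carrier (poly_ring n :: ('k::field) mpoly ring).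
       \<forall>m\<in>Poly_Mapping.keys f. \<exists>b\<in>P. mon_dvd b (m + u)}"
proof -
  let ?R = "poly_ring n :: 'k mpoly ring"
  interpret cring ?R by (rule cring_poly_ring)
  have keys: "Poly_Mapping.keys (f * monom u) = (\<lambda>m. m + u) ` Poly_Mapping.keys f"
    for f :: "'k mpoly"
  proof
    show "Poly_Mapping.keys (f * monom u) \<subseteq> (\<lambda>m. m + u) ` Poly_Mapping.keys f"
      using keys_mult[of f "monom u"] by auto
    show "(\<lambda>m. m + u) ` Poly_Mapping.keys f \<subseteq> Poly_Mapping.keys (f * monom u)"
      by (auto simp: in_keys_iff lookup_mult_monom)
  qed
  have "f * monom u \<in> carrier ?R" if "f \<in> carrier ?R" for f
    using m_closed[OF that monom_carrier[OF u]] by (simp add: poly_ring_def)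
  then show ?thesis
    by (auto simp: colon_def monomial_ideal_def keys) (auto simp: poly_ring_def keys)
qed

text \<open>If \<open>v\<close> divides \<open>m + u\<close> and \<open>u\<close> has a smaller
  exponent than \<open>v\<close> at \<open>i\<close>, then the i-th variable divides
  \<open>m\<close>. The second half of \<open>exch\<close> says that this variable lies in the colon
  ideal, so variables suffice to generate it.\<close>

lemma colon_linear:
  assumes u: "u \<in> monoms n"
    and exch: "\<And>v. v \<in> P \<Longrightarrow> \<exists>i\<in>{1..n}. \<exists>w\<in>P. Poly_Mapping.lookup u i < Poly_Mapping.lookup v i \<and>
      mon_dvd w (u + Poly_Mapping.single i 1)"
  shows "\<exists>V\<subseteq>{1..n}. colon (poly_ring n) (monomial_ideal n P) (monom u) =
    Idl\<^bsub>poly_ring n :: ('k::field) mpoly ring\<^esub> (var ` V)"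
proof -
  \<comment> \<open>All variables lying in the colon ideal.\<close>
  define V where "V = {i\<in>{1..n}. \<exists>w\<in>P. mon_dvd w (u + Poly_Mapping.single i 1)}"
  have "(\<exists>b\<in>P. mon_dvd b (m + u)) \<longleftrightarrow> (\<exists>i\<in>V. mon_dvd (Poly_Mapping.single i 1) m)" for m
  proof
    assume "\<exists>b\<in>P. mon_dvd b (m + u)"
    then obtain v where v: "v \<in> P" "mon_dvd v (m + u)" by blast
    then obtain i w where i: "i \<in> {1..n}" "w \<in> P" "mon_dvd w (u + Poly_Mapping.single i 1)"
      "Poly_Mapping.lookup u i < Poly_Mapping.lookup v i" using exch by blast
    have "Poly_Mapping.lookup v i \<le> Poly_Mapping.lookup m i + Poly_Mapping.lookup u i"
      using v(2) by (simp add: mon_dvd_def lookup_add)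
    with i have "mon_dvd (Poly_Mapping.single i 1) m" by (simp add: mon_dvd_single del: One_nat_def)
    with i show "\<exists>i\<in>V. mon_dvd (Poly_Mapping.single i 1) m" by (auto simp: V_def)
  next
    assume "\<exists>i\<in>V. mon_dvd (Poly_Mapping.single i 1) m"
    then obtain i w where "w \<in> P" "mon_dvd w (u + Poly_Mapping.single i 1)"
      "mon_dvd (Poly_Mapping.single i 1) m" by (auto simp: V_def)
    moreover from this(3) have "mon_dvd (u + Poly_Mapping.single i 1) (m + u)"
      using mon_dvd_add_mono[OF _ mon_dvd_refl[of u]] by (metis add.commute)
    ultimately show "\<exists>b\<in>P. mon_dvd b (m + u)" using mon_dvd_trans by blast
  qed
  moreover have "V \<subseteq> {1..n}" by (auto simp: V_def)
  ultimately show ?thesis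
    unfolding colon_monomial_ideal[OF u]
    by (intro exI[of _ V]) (simp add: genideal_var monomial_ideal_def)
qed

lemma set_take_sorted_desc:
  fixes us :: "'a::linorder list"
  assumes us: "sorted_wrt (>) us" and k: "k < length us"
  shows "set (take k us) = {v \<in> set us. us ! k < v}"
proof (intro Set.set_eqI iffI)
  fix v assume "v \<in> set (take k us)"
  then obtain l where "l < k" "v = us ! l"
    using k by (metis in_set_conv_nth length_take min.strict_boundedE nth_take)
  moreover from this have "us ! l \<in> set us" using k by (intro nth_mem) simp
  ultimately show "v \<in> {v \<in> set us. us ! k < v}"
    using us k by (simp add: sorted_wrt_iff_nth_less)
next
  fix v assume "v \<in> {v \<in> set us. us ! k < v}"
  then obtain l where l: "l < length us" "v = us ! l" "us ! k < us ! l"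
    by (auto simp: in_set_conv_nth)
  have "l < k"
  proof (rule ccontr)
    assume "\<not> l < k"
    then have "k < l" using l(3) by (cases "k = l") auto
    then have "us ! l < us ! k"
      using us l(1) by (simp add: sorted_wrt_iff_nth_less)
    with l(3) show False by simp
  qed
  with l k show "v \<in> set (take k us)" by (auto simp: in_set_conv_nth intro!: exI[of _ l])
qed

text \<open>The clause \<open>u < w\<close> in \<open>exch\<close> places the exchanged generator
  among those preceding \<open>u\<close>, so that \<open>colon_linear\<close> applies to the initial
  segment.\<close>

lemma colon_lex_initial:
  assumes B: "B \<subseteq> monoms n" and us: "sorted_wrt (>) us" "set us = B" and k: "k < length us"
    and exch: "\<And>u v. u \<in> B \<Longrightarrow> v \<in> B \<Longrightarrow> u < v \<Longrightarrow>
      \<exists>i\<in>{1..n}. \<exists>w\<in>B. u < w \<and> Poly_Mapping.lookup u i < Poly_Mapping.lookup v i \<and>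
        mon_dvd w (u + Poly_Mapping.single i 1)"
  shows "\<exists>V \<subseteq> {1..n}.
    colon (poly_ring n :: ('k::field) mpoly ring) (Idl\<^bsub>poly_ring n\<^esub> (monom ` set (take k us))) (monom (us ! k))
      = Idl\<^bsub>poly_ring n\<^esub> (var ` V)"
proof -
  let ?P = "set (take k us)"
  have P: "?P = {v \<in> B. us ! k < v}"
    using set_take_sorted_desc[OF us(1) k] us(2) by simp
  have u: "us ! k \<in> B" using k us by auto
  then have "us ! k \<in> monoms n" using B by blast
  moreover have "?P \<subseteq> monoms n" using P B by blast
  moreover have "\<exists>i\<in>{1..n}. \<exists>w\<in>?P. Poly_Mapping.lookup (us ! k) i < Poly_Mapping.lookup v i \<and>
      mon_dvd w (us ! k + Poly_Mapping.single i 1)" if "v \<in> ?P" for v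
    using exch[OF u, of v] that unfolding P by blast
  ultimately show ?thesis
    unfolding genideal_monom[OF \<open>?P \<subseteq> monoms n\<close>] by (intro colon_linear)
qed


section \<open>Products of edges of an anti-\<open>d\<close>-path\<close>

definition edge_monoms :: "nat \<Rightarrow> nat \<Rightarrow> mon set" where
  "edge_monoms d n =
     {Poly_Mapping.single i 1 + Poly_Mapping.single j 1 | i j. 1 \<le> i \<and> i + d < j \<and> j \<le> n}"

text \<open>Letting \<open>s\<close> range over all naturals avoids boundary cases: where a window
  sticks out of \<open>{1..n}\<close> the exponents are zero. For the same reason the sum over
  \<open>{..n}\<close> is the full degree.\<close>

definition window_bounded :: "nat \<Rightarrow> nat \<Rightarrow> nat \<Rightarrow> mon set" where
  "window_bounded d n k = {m \<in> monoms n. (\<Sum>i\<le>n. Poly_Mapping.lookup m i) = 2 * k \<and>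
     (\<forall>s. (\<Sum>i\<in>{s..s + d}. Poly_Mapping.lookup m i) \<le> k)}"

lemma sum_lookup_single:
  assumes "finite A"
  shows "(\<Sum>x\<in>A. Poly_Mapping.lookup (Poly_Mapping.single i (1::nat)) x) = (if i \<in> A then 1 else 0)"
  using assms by (simp add: lookup_single when_def sum.delta)

lemma lookup_outside_monoms: "m \<in> monoms n \<Longrightarrow> x \<notin> {1..n} \<Longrightarrow> Poly_Mapping.lookup m x = 0"
  by (auto simp: monoms_def in_keys_iff)

text \<open>Listing the indices with multiplicity as \<open>v\<^sub>1 \<le> \<dots> \<le> v\<^bsub>2k+2\<^esub>\<close>, the proof takes
  \<open>i = v\<^sub>1\<close> and \<open>j = v\<^bsub>k+2\<^esub>\<close>: any \<open>k + 1\<close> consecutive entries contain one of these two positions.\<close>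

lemma edge_meeting_full_windows:
  fixes f :: "nat \<Rightarrow> nat"
  assumes zero: "\<And>x. n < x \<Longrightarrow> f x = 0"
    and total: "(\<Sum>x\<le>n. f x) = 2 * Suc k"
    and win: "\<And>s. (\<Sum>x\<in>{s..s + d}. f x) \<le> Suc k"
  obtains i j where "i + d < j" "0 < f i" "0 < f j" "j \<le> n"
    "\<And>s. (\<Sum>x\<in>{s..s + d}. f x) = Suc k \<Longrightarrow> i \<in> {s..s + d} \<or> j \<in> {s..s + d}"
proof -
  define i where "i = (LEAST i. 0 < f i)"
  \<comment> \<open>The first index whose prefix holds \<open>k + 2\<close> entries counted with
    multiplicity, hence the value of the entry in position \<open>k + 2\<close>.\<close>
  define j where "j = (LEAST j. Suc (Suc k) \<le> (\<Sum>x\<le>j. f x))"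
  have "\<exists>i. 0 < f i" using total by (metis gr0I mult_is_0 nat.distinct(1) sum.neutral zero_neq_numeral)
  then have fi: "0 < f i" unfolding i_def by (rule LeastI_ex)
  have below: "f x = 0" if "x < i" for x
    using not_less_Least that unfolding i_def by blast
  have n: "Suc (Suc k) \<le> (\<Sum>x\<le>n. f x)" using total by simp
  then have j: "Suc (Suc k) \<le> (\<Sum>x\<le>j. f x)" unfolding j_def by (rule LeastI)
  have "j \<le> n" unfolding j_def using n by (rule Least_le)
  have jless: "(\<Sum>x\<le>y. f x) \<le> Suc k" if "y < j" for y
    using not_less_Least[of y] that unfolding j_def by force
  have split: "(\<Sum>x\<le>s + d. f x) = (\<Sum>x<s. f x) + (\<Sum>x\<in>{s..s + d}. f x)" for s
  proof -
    have "{..s + d} = {..<s} \<union> {s..s + d}" by auto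
    then show ?thesis by (simp add: sum.union_disjoint ivl_disj_int)
  qed
  have mono: "(\<Sum>x\<le>a. f x) \<le> (\<Sum>x\<le>b. f x)" if "a \<le> b" for a b
    using that by (intro sum_mono2) auto
  have "i + d < j"
  proof (rule ccontr)
    assume "\<not> i + d < j"
    \<comment> \<open>Nothing lies below \<open>i\<close>, so the window starting at
      \<open>i\<close> would hold \<open>k + 2\<close> entries.\<close>
    then have "Suc (Suc k) \<le> (\<Sum>x\<le>i + d. f x)" using j mono[of j "i + d"] by simp
    moreover have "(\<Sum>x<i. f x) = 0" using below by simp
    ultimately show False using split[of i] win[of i] by simp
  qed
  moreover have "0 < f j"
  proof (rule ccontr)
    assume "\<not> 0 < f j"
    moreover obtain y where "j = Suc y" using \<open>i + d < j\<close> by (cases j) auto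
    ultimately show False using j jless[of y] by simp
  qed
  moreover have "i \<in> {s..s + d} \<or> j \<in> {s..s + d}"
    if full: "(\<Sum>x\<in>{s..s + d}. f x) = Suc k" for s
  proof (rule ccontr)
    \<comment> \<open>A full window missing both indices cannot end before \<open>i\<close>, since
      it would be empty. So it starts after \<open>i\<close>, and its \<open>k + 1\<close> entries
      together with \<open>i\<close> push the prefix to \<open>k + 2\<close>, so that
      \<open>j \<le> s + d\<close>. Hence it starts after \<open>j\<close> as well, and
      \<open>k + 2\<close> entries before it plus \<open>k + 1\<close> inside exceed the total
      \<open>2 * k + 2\<close>.\<close>
    assume out: "\<not> ?thesis"
    have "\<not> s + d < i"
    proof
      assume "s + d < i"
      then have "(\<Sum>x\<in>{s..s + d}. f x) = 0" using below by simp
      with full show False by simp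
    qed
    with out have "i < s" by auto
    then have "0 < (\<Sum>x<s. f x)" using fi by (metis finite_lessThan lessThan_iff not_gr0 sum_eq_0_iff)
    then have "Suc (Suc k) \<le> (\<Sum>x\<le>s + d. f x)" using split[of s] full by simp
    then have "\<not> s + d < j" using jless[of "s + d"] by force
    with out have "j < s" by auto
    have "Suc (Suc k) \<le> (\<Sum>x<s. f x)"
    proof -
      have "(\<Sum>x\<le>j. f x) \<le> (\<Sum>x<s. f x)" using \<open>j < s\<close> by (intro sum_mono2) auto
      with j show ?thesis by simp
    qed
    then have big: "2 * Suc k < (\<Sum>x\<le>s + d. f x)" using split[of s] full by simp
    \<comment> \<open>The window may reach beyond \<open>n\<close>, where \<open>f\<close>
      vanishes.\<close>
    have "(\<Sum>x\<le>s + d. f x) \<le> (\<Sum>x\<le>max n (s + d). f x)" by (rule mono) simp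
    also have "\<dots> = (\<Sum>x\<le>n. f x)" using zero by (intro sum.mono_neutral_right) auto
    finally show False using big total by simp
  qed
  ultimately show thesis using that fi \<open>j \<le> n\<close> by blast
qed

lemma window_bounded_0: "window_bounded d n 0 = {0}"
proof -
  have "m = 0" if "m \<in> window_bounded d n 0" for m
  proof (rule poly_mapping_eqI)
    fix x
    show "Poly_Mapping.lookup m x = Poly_Mapping.lookup 0 x"
      using that lookup_outside_monoms[of m n x] by (cases "x \<in> {1..n}") (auto simp: window_bounded_def)
  qed
  then show ?thesis by (auto simp: window_bounded_def monoms_zero)
qed

lemma window_bounded_Suc:
  "window_bounded d n (Suc k) = {a + e | a e. a \<in> window_bounded d n k \<and> e \<in> edge_monoms d n}"
proof (intro Set.set_eqI iffI)
  fix m assume m: "m \<in> window_bounded d n (Suc k)"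
  then have mon: "m \<in> monoms n" by (simp add: window_bounded_def)
  have zero: "Poly_Mapping.lookup m x = 0" if "n < x" for x
    using lookup_outside_monoms[OF mon] that by simp
  obtain i j where ij: "i + d < j" "0 < Poly_Mapping.lookup m i" "0 < Poly_Mapping.lookup m j" "j \<le> n"
    and meet: "\<And>s. (\<Sum>x\<in>{s..s + d}. Poly_Mapping.lookup m x) = Suc k \<Longrightarrow> i \<in> {s..s + d} \<or> j \<in> {s..s + d}"
    using edge_meeting_full_windows[of n "Poly_Mapping.lookup m" k d] zero m
    by (auto simp: window_bounded_def simp del: mult_Suc_right)
  define e :: mon where "e = Poly_Mapping.single i 1 + Poly_Mapping.single j 1"
  have "mon_dvd e m"
    using ij by (auto simp: mon_dvd_def e_def lookup_add lookup_single when_def)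
  then obtain a where a: "m = a + e" by (metis mon_dvd_iff add.commute)
  have sums: "(\<Sum>x\<in>A. Poly_Mapping.lookup m x) = (\<Sum>x\<in>A. Poly_Mapping.lookup a x) +
      (if i \<in> A then 1 else 0) + (if j \<in> A then 1 else 0)" if "finite A" for A
    using that by (simp add: a e_def lookup_add sum.distrib sum_lookup_single del: One_nat_def)
  have "1 \<le> i" using lookup_outside_monoms[OF mon, of i] ij(2) by (cases "i = 0") auto
  then have "e \<in> edge_monoms d n" using ij by (auto simp: e_def edge_monoms_def)
  moreover have "a \<in> window_bounded d n k"
  proof -
    have "mon_dvd a m" by (auto simp: a mon_dvd_def lookup_add)
    then have "a \<in> monoms n" using mon monoms_dvd by blast
    moreover have "(\<Sum>x\<le>n. Poly_Mapping.lookup a x) = 2 * k"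
      using m sums[of "{..n}"] ij by (simp add: window_bounded_def)
    moreover have "(\<Sum>x\<in>{s..s + d}. Poly_Mapping.lookup a x) \<le> k" for s
    proof -
      have "(\<Sum>x\<in>{s..s + d}. Poly_Mapping.lookup m x) \<le> Suc k"
        using m by (simp add: window_bounded_def)
      \<comment> \<open>A full window loses at least one from \<open>e\<close>; any other window
        already has sum at most \<open>k\<close>.\<close>
      then show ?thesis
        using sums[of "{s..s + d}"] meet[of s]
        by (cases "(\<Sum>x\<in>{s..s + d}. Poly_Mapping.lookup m x) = Suc k") (auto split: if_splits)
    qed
    ultimately show ?thesis by (simp add: window_bounded_def)
  qed
  ultimately show "m \<in> {a + e | a e. a \<in> window_bounded d n k \<and> e \<in> edge_monoms d n}"
    using a by blast
next
  fix m assume "m \<in> {a + e | a e. a \<in> window_bounded d n k \<and> e \<in> edge_monoms d n}"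
  then obtain a i j where a: "a \<in> window_bounded d n k"
    and ij: "1 \<le> i" "i + d < j" "j \<le> n"
    and m: "m = a + (Poly_Mapping.single i 1 + Poly_Mapping.single j 1)"
    by (auto simp: edge_monoms_def)
  have sums: "(\<Sum>x\<in>A. Poly_Mapping.lookup m x) = (\<Sum>x\<in>A. Poly_Mapping.lookup a x) +
      (if i \<in> A then 1 else 0) + (if j \<in> A then 1 else 0)" if "finite A" for A
    using that by (simp add: m lookup_add sum.distrib sum_lookup_single del: One_nat_def)
  have "m \<in> monoms n"
    using a ij unfolding m by (intro monoms_add monoms_single) (auto simp: window_bounded_def)
  moreover have "(\<Sum>x\<le>n. Poly_Mapping.lookup m x) = 2 * Suc k"
    using sums[of "{..n}"] a ij by (simp add: window_bounded_def)
  moreover have "(\<Sum>x\<in>{s..s + d}. Poly_Mapping.lookup m x) \<le> Suc k" for s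
  proof -
    have "(\<Sum>x\<in>{s..s + d}. Poly_Mapping.lookup a x) \<le> k"
      using a by (simp add: window_bounded_def)
    \<comment> \<open>Since \<open>i + d < j\<close>, no window of length \<open>d + 1\<close>
      contains both ends of the edge.\<close>
    then show ?thesis using sums[of "{s..s + d}"] ij(2) by auto
  qed
  ultimately show "m \<in> window_bounded d n (Suc k)" by (simp add: window_bounded_def)
qed

text \<open>All these monomials have degree \<open>2 * k\<close>, and a pointwise inequality between
  functions with equal finite sums is an equality.\<close>

lemma window_bounded_antichain:
  assumes "b \<in> window_bounded d n k" "c \<in> window_bounded d n k" "mon_dvd b c"
  shows "b = c"
proof (rule poly_mapping_eqI)
  fix x
  show "Poly_Mapping.lookup b x = Poly_Mapping.lookup c x"
  proof (cases "x \<in> {1..n}")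
    case True
    have "(\<Sum>x\<le>n. Poly_Mapping.lookup b x) = (\<Sum>x\<le>n. Poly_Mapping.lookup c x)"
      using assms(1,2) by (simp add: window_bounded_def)
    then show ?thesis
      by (rule sum_mono_inv) (use True assms(3) in \<open>auto simp: mon_dvd_def\<close>)
  next
    case False
    then show ?thesis
      using assms lookup_outside_monoms[of _ n x] by (simp add: window_bounded_def)
  qed
qed

text \<open>Each exponent is bounded by the degree and the support lies in \<open>{1..n}\<close>.
  Finiteness is what lets the generators be listed in decreasing order.\<close>

lemma finite_window_bounded: "finite (window_bounded d n k)"
proof (rule finite_imageD)
  let ?F = "{f. \<forall>x. (x \<in> {1..n} \<longrightarrow> f x \<in> {..2 * k}) \<and> (x \<notin> {1..n} \<longrightarrow> f x = 0)}"
  have "Poly_Mapping.lookup m \<in> ?F" if m: "m \<in> window_bounded d n k" for m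
  proof -
    have "Poly_Mapping.lookup m x \<le> 2 * k" if "x \<le> n" for x
      using m member_le_sum[of x "{..n}" "Poly_Mapping.lookup m"] that
      by (simp add: window_bounded_def)
    moreover have "Poly_Mapping.lookup m x = 0" if "x \<notin> {1..n}" for x
      using m that lookup_outside_monoms[of m n x] by (simp add: window_bounded_def)
    ultimately show ?thesis by (simp del: One_nat_def)
  qed
  then show "finite (Poly_Mapping.lookup ` window_bounded d n k)"
    by (intro finite_subset[OF _ finite_set_of_finite_funs[of "{1..n}" "{..2 * k}" 0]]) auto
  show "inj_on Poly_Mapping.lookup (window_bounded d n k)"
    by (simp add: inj_on_def Poly_Mapping.lookup_inject)
qed

section \<open>The exchange property\<close>

lemma index_in_full_windows:
  fixes f g :: "nat \<Rightarrow> nat"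
  assumes win: "\<And>s. (\<Sum>x\<in>{s..s + d}. g x) \<le> k"
    and total: "(\<Sum>x\<le>n. f x) = (\<Sum>x\<le>n. g x)"
    and lex: "f i < g i" "\<And>x. x < i \<Longrightarrow> f x = g x" "i \<le> n"
  obtains q where "i < q" "0 < f q"
    "\<And>s. i \<in> {s..s + d} \<Longrightarrow> (\<Sum>x\<in>{s..s + d}. f x) = k \<Longrightarrow> q \<in> {s..s + d}"
proof -
  \<comment> \<open>The deficit of \<open>f\<close> at \<open>i\<close> must be compensated inside
    \<open>A\<close>, and not before \<open>i\<close>, where \<open>f\<close> and \<open>g\<close>
    agree. If \<open>f\<close> vanished on \<open>A\<close> after \<open>i\<close>, it would be at
    most \<open>g\<close> throughout \<open>A\<close> and smaller at \<open>i\<close>.\<close>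
  have ex: "\<exists>q\<in>A. i < q \<and> 0 < f q"
    if A: "finite A" "i \<in> A" "(\<Sum>x\<in>A. g x) \<le> (\<Sum>x\<in>A. f x)" for A
  proof (rule ccontr)
    assume none: "\<not> ?thesis"
    have "f x \<le> g x" if "x \<in> A" for x
    proof (cases x i rule: linorder_cases)
      case greater
      then show ?thesis using none that by simp
    qed (use lex in simp_all)
    then have "(\<Sum>x\<in>A. f x) < (\<Sum>x\<in>A. g x)"
      using A lex(1) by (intro sum_strict_mono_ex1) auto
    with A show False by simp
  qed
  let ?full = "\<lambda>s. i \<in> {s..s + d} \<and> (\<Sum>x\<in>{s..s + d}. f x) = k"
  show thesis
  proof (cases "\<exists>s. ?full s")
    case True
    define s where "s = (LEAST s. ?full s)"
    have s: "?full s" unfolding s_def using True by (rule LeastI_ex)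
    then obtain q where q: "q \<in> {s..s + d}" "i < q" "0 < f q"
      using ex[of "{s..s + d}"] win[of s] by auto
    have "q \<in> {t..t + d}" if "?full t" for t
    proof -
      have "s \<le> t" unfolding s_def using that by (rule Least_le)
      \<comment> \<open>Here \<open>s \<le> t \<le> i < q \<le> s + d \<le> t + d\<close>, by the
        leftmost choice of \<open>s\<close>.\<close>
      then show ?thesis using q that by auto
    qed
    with q that show thesis by blast
  next
    case False
    \<comment> \<open>Without a full window around \<open>i\<close> the last condition is vacuous,
      and the equal totals over \<open>{..n}\<close> provide \<open>q\<close>.\<close>
    then show thesis using ex[of "{..n}"] total lex(3) that by auto
  qed
qed

lemma window_bounded_exchange:
  assumes u: "u \<in> window_bounded d n k" and v: "v \<in> window_bounded d n k" and "u < v"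
  shows "\<exists>i\<in>{1..n}. \<exists>w\<in>window_bounded d n k. u < w \<and>
    Poly_Mapping.lookup u i < Poly_Mapping.lookup v i \<and> mon_dvd w (u + Poly_Mapping.single i 1)"
proof -
  have mon: "u \<in> monoms n" "v \<in> monoms n" using u v by (auto simp: window_bounded_def)
  obtain i where i: "Poly_Mapping.lookup u i < Poly_Mapping.lookup v i"
    "\<And>x. x < i \<Longrightarrow> Poly_Mapping.lookup u x = Poly_Mapping.lookup v x"
    using \<open>u < v\<close> by (auto simp: lex_less_iff)
  have in_n: "i \<in> {1..n}" using i(1) lookup_outside_monoms[OF mon(2), of i] by force
  obtain q where q: "i < q" "0 < Poly_Mapping.lookup u q"
    and full: "\<And>s. i \<in> {s..s + d} \<Longrightarrow> (\<Sum>x\<in>{s..s + d}. Poly_Mapping.lookup u x) = k \<Longrightarrow> q \<in> {s..s + d}"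
    using index_in_full_windows[where f = "Poly_Mapping.lookup u" and g = "Poly_Mapping.lookup v"
        and i = i and d = d and k = k and n = n] i in_n u v
    by (auto simp: window_bounded_def)
  have "mon_dvd (Poly_Mapping.single q 1) u" using q by (simp add: mon_dvd_single del: One_nat_def)
  then obtain a where a: "u = a + Poly_Mapping.single q 1" by (metis mon_dvd_iff add.commute)
  define w where "w = a + Poly_Mapping.single i 1"
  \<comment> \<open>\<open>w\<close> is \<open>u\<close> with one unit moved from \<open>q\<close>
    to \<open>i\<close>; the balance is stated additively to avoid truncated subtraction.\<close>
  have sums: "(\<Sum>x\<in>A. Poly_Mapping.lookup w x) + (if q \<in> A then 1 else 0) =
      (\<Sum>x\<in>A. Poly_Mapping.lookup u x) + (if i \<in> A then 1 else 0)" if "finite A" for A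
    using that by (simp add: a w_def lookup_add sum.distrib sum_lookup_single del: One_nat_def)
  have q_n: "q \<le> n" using q(2) lookup_outside_monoms[OF mon(1), of q] by force
  have dvd: "mon_dvd w (u + Poly_Mapping.single i 1)"
    by (simp add: mon_dvd_def w_def a lookup_add)
  then have "w \<in> monoms n"
    using monoms_dvd monoms_add[OF mon(1) monoms_single[OF in_n]] by blast
  moreover have "(\<Sum>x\<le>n. Poly_Mapping.lookup w x) = 2 * k"
    using sums[of "{..n}"] u in_n q_n by (simp add: window_bounded_def)
  moreover have "(\<Sum>x\<in>{s..s + d}. Poly_Mapping.lookup w x) \<le> k" for s
  proof -
    have "(\<Sum>x\<in>{s..s + d}. Poly_Mapping.lookup u x) \<le> k"
      using u by (simp add: window_bounded_def)
    \<comment> \<open>A window that gains at \<open>i\<close> either has room or is full, and then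
      it also contains \<open>q\<close> and its sum is unchanged.\<close>
    then show ?thesis using sums[of "{s..s + d}"] full[of s]
      by (cases "(\<Sum>x\<in>{s..s + d}. Poly_Mapping.lookup u x) = k") (auto split: if_splits)
  qed
  ultimately have "w \<in> window_bounded d n k" by (simp add: window_bounded_def)
  \<comment> \<open>As \<open>i < q\<close>, the first change is the increase at
    \<open>i\<close>.\<close>
  moreover have "u < w"
    unfolding lex_less_iff using q(1)
    by (intro exI[of _ i]) (auto simp: w_def a lookup_add lookup_single when_def)
  ultimately show ?thesis using in_n i(1) dvd by blast
qed

section \<open>Powers of the edge ideal and their linear quotients\<close>

lemma edge_ideal_anti_d_path:
  assumes "n \<ge> d + 1"
  shows "edge_ideal n (complement_edges n (d_path d n)) =
    (monomial_ideal n (edge_monoms d n) :: ('k::field) mpoly set)"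
proof -
  have "{var i \<otimes>\<^bsub>poly_ring n\<^esub> var j :: 'k mpoly | i j. 1 \<le> i \<and> i + d < j \<and> j \<le> n} =
      monom ` edge_monoms d n"
    by (fastforce simp: edge_monoms_def var_def monom_add poly_ring_def image_iff)
  moreover have "edge_monoms d n \<subseteq> monoms n"
    by (auto simp: edge_monoms_def simp del: One_nat_def intro!: monoms_add monoms_single)
  ultimately show ?thesis
    by (simp add: edge_ideal_complement_d_path[OF assms] genideal_monom)
qed

text \<open>The power is taken in the monoid of ideals: its unit is the whole ring, generated by the
  monomial with exponent \<open>0\<close>, and each further factor multiplies the generators by one
  edge, as in \<open>window_bounded_Suc\<close>.\<close>

lemma power_edge_ideal_anti_d_path:
  assumes "n \<ge> d + 1"
  shows "edge_ideal n (complement_edges n (d_path d n)) [^]\<^bsub>ideals_set (poly_ring n)\<^esub> k =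
    (monomial_ideal n (window_bounded d n k) :: ('k::field) mpoly set)"
proof (induction k)
  case 0
  then show ?case
    by (simp add: nat_pow_def ideals_set_def window_bounded_0 monomial_ideal_zero)
next
  case (Suc k)
  have "edge_monoms d n \<subseteq> monoms n" "window_bounded d n k \<subseteq> monoms n"
    by (auto simp: edge_monoms_def window_bounded_def simp del: One_nat_def
        intro!: monoms_add monoms_single)
  then show ?case
    using Suc edge_ideal_anti_d_path[OF assms, where 'k = 'k]
    by (simp add: nat_pow_def ideals_set_def monomial_ideal_prod window_bounded_Suc)
qed

theorem proposition3p3:
  fixes d n k :: nat and I J :: "('k::field) mpoly set"
  assumes "d \<ge> 1" and "n \<ge> d + 1" and "k \<ge> 1"
    and "I = edge_ideal n (complement_edges n (d_path d n))"
    and "J = I [^]\<^bsub>ideals_set (poly_ring n)\<^esub> k"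
  shows "(\<exists>us. decreasing_lex_generators n J us) \<and>
    (\<forall>us. decreasing_lex_generators n J us \<longrightarrow> linear_quotients n J us)"
proof -
  let ?B = "window_bounded d n k"
  have J: "J = monomial_ideal n ?B"
    using assms(4,5) power_edge_ideal_anti_d_path[OF assms(2)] by simp
  have B: "?B \<subseteq> monoms n" by (auto simp: window_bounded_def)
  have gens: "minimal_monomial_generators n J C \<longleftrightarrow> C = ?B" for C
    unfolding J by (rule minimal_monomial_generators_unique[OF window_bounded_antichain B])
  \<comment> \<open>A witness for the first conjunct, so the universal statement about decreasing
    lists is not vacuous.\<close>
  have "decreasing_lex_generators n J (rev (sorted_list_of_set ?B))"
    using finite_window_bounded by (simp add: decreasing_lex_generators_def gens sorted_wrt_rev)
  moreover have "linear_quotients n J us" if "decreasing_lex_generators n J us" for us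
  proof -
    have us: "sorted_wrt (>) us" "set us = ?B"
      using that by (simp_all add: decreasing_lex_generators_def gens)
    then have "distinct us"
      by (metis distinct_rev sorted_wrt_rev strict_sorted_iff)
    then show ?thesis
      using colon_lex_initial[where 'k = 'k, OF B us _ window_bounded_exchange] us(2)
      by (simp add: linear_quotients_def gens)
  qed
  ultimately show ?thesis by blast
qed

end
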